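(* Let $\phi=\frac{1+\sqrt5}{2}$. Then: (1) The period $\{1,\phi\}$ generates a fractal monoid. (2) The unique nonbisectional normalized fractal monoid of granularity $2$ is exactly the fractal monoid generated by the period $\{1,\phi\}$.
   Context: $\mathbb{N}=\{1,2,3,\dots\}$. A tempered monoid is a strictly increasing sequence $M=\{\mu_1,\mu_2,\mu_3,\dots\}$ of non-negative real numbers such that (i) $\mu_1=0$; (ii) $\lim_{n\to\infty}(\mu_{n+1}-\mu_n)=0$; (iii) $M$ is closed under addition, that is, for any $i,j\in\mathbb{N}$ there exists $k\in\mathbb{N}$ such that $\mu_k=\mu_i+\mu_j$. It is normalized if its smallest non-zero element is $1$. If $M$ is a normalized tempered monoid and $i\in\mathbb{N}$, its $i$-th period $\pi_i(M)$ is the set of elements of $M$ that are at least $i$ and strictly smaller than $i+1$. The granularity of $M$ is the cardinality of its first period $\pi_1(M)$. Let $M$ be a normalized tempered monoid with granularity $\ell$. For $i\in\mathbb{N}$ let $\ell_i$ be the cardinality of $\pi_i(M)$ and write $\pi_i(M)=\{i+\tau^{(i)}_0,i+\tau^{(i)}_1,\dots,i+\tau^{(i)}_{\ell_i-1}\}$ with $\tau^{(i)}_0=0<\tau^{(i)}_1<\dots<\tau^{(i)}_{\ell_i-1}<\tau^{(i)}_{\ell_i}=1$ (the value $\tau^{(i)}_{\ell_i}=1$ being a convention). $M$ is called fractal (a fractal monoid) if for every $i\in\mathbb{N}$ $$\pi_{i+1}(M)=\bigcup_{r=0}^{\ell_i-1}\ \bigcup_{s=0}^{\ell-1}\left\{(i+1)+\tau^{(i)}_r+\tau^{(1)}_s\left(\tau^{(i)}_{r+1}-\tau^{(i)}_r\right)\right\}.$$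 Given a finite set $P\subset[1,2)$ with $1\in P$, there is exactly one sequence of sets $\pi_1=P,\pi_2,\pi_3,\dots$ obeying the recursion above. One says that the period $P$ generates a fractal monoid if the resulting set $\{0\}\cup\bigcup_{i\ge1}\pi_i$ is a tempered monoid (in particular, closed under addition); this set is then the fractal monoid generated by $P$, and it is the only fractal monoid with first period $P$. The bisectional fractal monoid is the fractal monoid generated by the period $\{1,1+\tfrac12\}$; a fractal monoid of granularity $2$ is nonbisectional if it is different from the bisectional fractal monoid. *)

theory Defs imports Complex_Main begin

text \<open>Sequences are indexed from 0 here, so \<open>\<mu> 0\<close> is the element \<open>\<mu>\<^sub>1\<close> of the
  usual notation. A tempered monoid is identified with the set of terms of its sequence, which
  determines the (strictly increasing) sequence.\<close>

definition tempered_sequence :: "(nat \<Rightarrow> real) \<Rightarrow> bool" where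
  "tempered_sequence \<mu> \<longleftrightarrow>
     strict_mono \<mu> \<and> (\<forall>n. 0 \<le> \<mu> n) \<and> \<mu> 0 = 0 \<and>
     (\<lambda>n. \<mu> (Suc n) - \<mu> n) \<longlonglongrightarrow> 0 \<and>
     (\<forall>i j. \<exists>k. \<mu> k = \<mu> i + \<mu> j)"

definition tempered_monoid :: "real set \<Rightarrow> bool" where
  "tempered_monoid M \<longleftrightarrow> (\<exists>\<mu>. tempered_sequence \<mu> \<and> M = range \<mu>)"

definition normalized :: "real set \<Rightarrow> bool" where
  "normalized M \<longleftrightarrow> 1 \<in> M \<and> (\<forall>x\<in>M. x \<noteq> 0 \<longrightarrow> 1 \<le> x)"

definition period :: "real set \<Rightarrow> nat \<Rightarrow> real set" where
  "period M i = {x \<in> M. real i \<le> x \<and> x < real i + 1}"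

definition granularity :: "real set \<Rightarrow> nat" where
  "granularity M = card (period M 1)"

text \<open>For a finite set \<open>Q\<close> of reals in \<open>[i, i + 1)\<close>, \<open>offset i Q r\<close> is \<open>\<tau>\<close> with upper index \<open>i\<close>
  and lower index \<open>r\<close>: the elements of \<open>Q\<close> are \<open>i + offset i Q r\<close> in increasing order for
  \<open>r < card Q\<close>, and \<open>offset i Q (card Q) = 1\<close> by convention.\<close>

definition offset :: "nat \<Rightarrow> real set \<Rightarrow> nat \<Rightarrow> real" where
  "offset i Q r = (if r < card Q then sorted_list_of_set Q ! r - real i else 1)"

text \<open>The \<open>(i + 1)\<close>-st period prescribed by the first period \<open>P\<close> and the \<open>i\<close>-th period \<open>Q\<close>.\<close>

definition next_period :: "real set \<Rightarrow> nat \<Rightarrow> real set \<Rightarrow> real set" where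
  "next_period P i Q =
     (\<Union>r\<in>{..<card Q}. \<Union>s\<in>{..<card P}.
        {(real i + 1) + offset i Q r + offset 1 P s * (offset i Q (Suc r) - offset i Q r)})"

definition fractal_monoid :: "real set \<Rightarrow> bool" where
  "fractal_monoid M \<longleftrightarrow>
     tempered_monoid M \<and> normalized M \<and>
     (\<forall>i\<ge>1. period M (i + 1) = next_period (period M 1) i (period M i))"

text \<open>The recursion starts at index 1; the value at 0 is a placeholder.\<close>

fun generated_period :: "real set \<Rightarrow> nat \<Rightarrow> real set" where
  "generated_period P 0 = {}"
| "generated_period P (Suc 0) = P"
| "generated_period P (Suc (Suc n)) = next_period P (Suc n) (generated_period P (Suc n))"

definition generated_set :: "real set \<Rightarrow> real set" where
  "generated_set P = {0} \<union> (\<Union>i\<in>{1..}. generated_period P i)"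

definition generates_fractal_monoid :: "real set \<Rightarrow> bool" where
  "generates_fractal_monoid P \<longleftrightarrow>
     finite P \<and> P \<subseteq> {1..<2} \<and> 1 \<in> P \<and> tempered_monoid (generated_set P)"

definition bisectional_monoid :: "real set" where
  "bisectional_monoid = generated_set {1, 1 + 1/2}"

definition nonbisectional :: "real set \<Rightarrow> bool" where
  "nonbisectional M \<longleftrightarrow> fractal_monoid M \<and> granularity M = 2 \<and> M \<noteq> bisectional_monoid"

end

theory Submission imports Defs begin

text \<open>Write the first period as \<open>{1, 1 + a}\<close> with \<open>0 < a < 1\<close>. The recursion then says that the
  offsets of the elements of the \<open>i\<close>-th period are the left endpoints of the \<open>2 ^ i\<close> intervals
  obtained from \<open>[0, 1)\<close> by cutting \<open>i\<close> times every interval in the ratio \<open>a : 1 - a\<close>. Two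
  descriptions of this set are used.

  Refining from the bottom, element number \<open>n\<close> gives rise, one period later, to the elements number
  \<open>2 * n\<close> and \<open>2 * n + 1\<close>, when the elements are counted from 1. This makes the increasing
  enumeration of the generated set a binary recursion (\<open>fractal_enum\<close>) in which each doubling of the
  index multiplies the distance to the next element by \<open>a\<close> or \<open>1 - a\<close>. Hence distances are
  positive and tend to 0 for every \<open>a\<close>, and the only condition left for a tempered monoid is
  closure under addition (\<open>tempered_generated_set\<close>).

  Splitting at the top, the offsets of one period are the images of those of the previous period
  under the two maps \<open>x \<mapsto> a * x\<close> and \<open>x \<mapsto> a + (1 - a) * x\<close> (\<open>endpoints\<close>). Closure under addition
  means that, for \<open>x\<close> of level \<open>i\<close> and \<open>y\<close> of level \<open>j\<close>, either \<open>x + y\<close> has level \<open>i + j\<close> or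
  \<open>x + y - 1\<close> has level \<open>i + j + 1\<close>. If \<open>a * a = 1 - a\<close>, which holds for \<open>a = \<phi> - 1\<close>, the second map
  is \<open>x \<mapsto> a + a * a * x\<close>, so both scales are powers of \<open>a\<close>; stripping leading maps from \<open>x\<close> and \<open>y\<close>
  reduces their sum to sums of smaller total level (\<open>golden_endpoints_add\<close>).

  Conversely, closure under addition puts \<open>2 * (1 + a)\<close> into the second or third period. Comparing it
  with the explicit four or eight elements there leaves only \<open>a = 1 / 2\<close>, the bisectional case, and
  \<open>a * a = 1 - a\<close> (\<open>double_in_generated_set_imp\<close>). Since a fractal monoid is determined by its first
  period, the golden one is the only nonbisectional one of granularity 2.\<close>

section \<open>Enumerating the monoid generated by two elements\<close>

text \<open>The elements of the generated set in increasing order, counted from 1, so that the \<open>i\<close>-th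
  period occupies the indices from \<open>2 ^ i\<close> to \<open>2 ^ (i + 1) - 1\<close>, with 0 forming a period of its own
  for \<open>i = 0\<close>. The element following the last one of period \<open>i\<close> is \<open>i + 1\<close>, which agrees with the
  convention that the last offset is 1; therefore the last interval of a period needs no special
  treatment. The value at 0 is a default.\<close>

function fractal_enum :: "real \<Rightarrow> nat \<Rightarrow> real" where
  "fractal_enum a n =
     (if n \<le> 1 then 0
      else 1 + fractal_enum a (n div 2) +
        (if odd n then a * (fractal_enum a (n div 2 + 1) - fractal_enum a (n div 2)) else 0))"
  by auto
termination
  by (relation "measure snd") (auto elim!: oddE)

declare fractal_enum.simps [simp del]

lemma fractal_enum_1 [simp]: "fractal_enum a (Suc 0) = 0"
  by (simp add: fractal_enum.simps)

lemma fractal_enum_even: "n \<ge> 1 \<Longrightarrow> fractal_enum a (2 * n) = 1 + fractal_enum a n"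
  by (subst fractal_enum.simps) simp

lemma fractal_enum_odd:
  "n \<ge> 1 \<Longrightarrow> fractal_enum a (2 * n + 1) =
     1 + fractal_enum a n + a * (fractal_enum a (n + 1) - fractal_enum a n)"
  by (subst fractal_enum.simps) simp

lemma fractal_enum_2: "fractal_enum a 2 = 1"
  using fractal_enum_even[of 1 a] by simp

lemma fractal_enum_3: "fractal_enum a 3 = 1 + a"
  using fractal_enum_odd[of 1 a] fractal_enum_2[of a] by (simp add: numeral_3_eq_3 numeral_2_eq_2)

definition gap :: "real \<Rightarrow> nat \<Rightarrow> real" where
  "gap a n = fractal_enum a (n + 1) - fractal_enum a n"

lemma gap_1: "gap a 1 = 1"
  using fractal_enum_even[of 1 a] by (simp add: gap_def numeral_2_eq_2)

lemma gap_even: "n \<ge> 1 \<Longrightarrow> gap a (2 * n) = a * gap a n"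
  using fractal_enum_even[of n a] fractal_enum_odd[of n a] by (simp add: gap_def)

lemma gap_odd: "n \<ge> 1 \<Longrightarrow> gap a (2 * n + 1) = (1 - a) * gap a n"
  using fractal_enum_even[of "n + 1" a] fractal_enum_odd[of n a]
  by (simp add: gap_def algebra_simps)

lemma nat_double_cases:
  fixes n :: nat
  assumes "n \<ge> 1"
  obtains "n = 1" | m where "1 \<le> m" "m < n" "n = 2 * m" | m where "1 \<le> m" "m < n" "n = 2 * m + 1"
proof (cases "n = 1")
  case False
  then show ?thesis
    using that(2)[of "n div 2"] that(3)[of "n div 2"] assms
    by (cases "even n") (auto elim!: evenE oddE)
qed (use that in simp)

lemma gap_pos:
  assumes "0 < a" "a < 1" "n \<ge> 1"
  shows "0 < gap a n"
  using assms(3)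
proof (induction n rule: less_induct)
  case (less n)
  from less.prems show ?case
  proof (cases rule: nat_double_cases)
    case 1
    then show ?thesis by (simp add: gap_1[simplified])
  next
    case (2 m)
    then show ?thesis using less.IH[of m] assms gap_even[of m a] by simp
  next
    case (3 m)
    then show ?thesis using less.IH[of m] assms gap_odd[of m a] by simp
  qed
qed

lemma fractal_enum_less:
  assumes "0 < a" "a < 1" "1 \<le> m" "m < n"
  shows "fractal_enum a m < fractal_enum a n"
  using assms(4,3)
proof (induction rule: strict_inc_induct)
  case (base i)
  then show ?case using gap_pos[OF assms(1,2), of i] by (simp add: gap_def)
next
  case (step i)
  then show ?case using gap_pos[OF assms(1,2), of i] by (simp add: gap_def)
qed

text \<open>Every binary digit of \<open>n\<close> below the leading one contributes a factor \<open>a\<close> or \<open>1 - a\<close> to the gap.\<close>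

lemma gap_le_power:
  assumes "0 < a" "a < 1" "2 ^ k \<le> n"
  shows "gap a n \<le> max a (1 - a) ^ k"
  using assms(3)
proof (induction k arbitrary: n)
  case 0
  then have "n \<ge> 1" by simp
  then show ?case
  proof (induction n rule: less_induct)
    case (less n)
    from less.prems show ?case
    proof (cases rule: nat_double_cases)
      case 1
      then show ?thesis by (simp add: gap_1[simplified])
    next
      case (2 m)
      then show ?thesis
        using less.IH[of m] assms gap_even[of m a] gap_pos[OF assms(1,2), of m]
        by (simp add: mult_le_one)
    next
      case (3 m)
      then show ?thesis
        using less.IH[of m] assms gap_odd[of m a] gap_pos[OF assms(1,2), of m]
        by (simp add: mult_le_one)
    qed
  qed
next
  case (Suc k)
  define m where "m = n div 2"
  have m: "2 ^ k \<le> m" using Suc.prems by (simp add: m_def)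
  then have m1: "m \<ge> 1"
    by (meson le_trans one_le_numeral one_le_power)
  have "gap a n \<le> max a (1 - a) * gap a m"
  proof (cases "even n")
    case True
    then have "n = 2 * m" by (simp add: m_def)
    then show ?thesis
      using gap_even[OF m1, of a] gap_pos[OF assms(1,2) m1] by (simp add: mult_right_mono)
  next
    case False
    then have "n = 2 * m + 1" by (simp add: m_def)
    then show ?thesis
      using gap_odd[OF m1, of a] gap_pos[OF assms(1,2) m1] by (simp add: mult_right_mono)
  qed
  also have "\<dots> \<le> max a (1 - a) * max a (1 - a) ^ k"
    using Suc.IH[OF m] assms by (intro mult_left_mono) auto
  finally show ?case by simp
qed

lemma gap_tendsto_0:
  assumes "0 < a" "a < 1"
  shows "(\<lambda>n. gap a (Suc n)) \<longlonglongrightarrow> 0"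
proof (rule LIMSEQ_I)
  fix e :: real
  assume "0 < e"
  moreover have "max a (1 - a) < 1" using assms by auto
  ultimately obtain k where k: "max a (1 - a) ^ k < e"
    using real_arch_pow_inv by blast
  show "\<exists>no. \<forall>n\<ge>no. norm (gap a (Suc n) - 0) < e"
  proof (intro exI allI impI)
    fix n :: nat
    assume "2 ^ k \<le> n"
    then show "norm (gap a (Suc n) - 0) < e"
      using gap_le_power[OF assms, of k "Suc n"] gap_pos[OF assms, of "Suc n"] k by simp
  qed
qed

section \<open>Periods\<close>

lemma fractal_enum_power2: "fractal_enum a (2 ^ i) = real i"
proof (induction i)
  case (Suc i)
  then show ?case using fractal_enum_even[of "2 ^ i" a] by simp
qed simp

definition enum_period :: "real \<Rightarrow> nat \<Rightarrow> real set" where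
  "enum_period a i = fractal_enum a ` {2 ^ i..<2 ^ Suc i}"

lemma fractal_enum_inj:
  assumes "0 < a" "a < 1"
  shows "inj_on (fractal_enum a) {1..}"
  by (rule linorder_inj_onI) (use fractal_enum_less[OF assms] in force)+

lemma one_le_of_power2_le: "(2::nat) ^ i \<le> n \<Longrightarrow> 1 \<le> n"
  by (meson le_trans one_le_numeral one_le_power)

lemma card_enum_period:
  assumes "0 < a" "a < 1"
  shows "card (enum_period a i) = 2 ^ i"
proof -
  have "inj_on (fractal_enum a) {2 ^ i..<2 ^ Suc i}"
    by (rule inj_on_subset[OF fractal_enum_inj[OF assms]]) (auto dest: one_le_of_power2_le)
  then show ?thesis by (simp add: enum_period_def card_image)
qed

lemma sorted_list_of_enum_period:
  assumes "0 < a" "a < 1"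
  shows "sorted_list_of_set (enum_period a i) = map (fractal_enum a) [2 ^ i..<2 ^ Suc i]"
proof -
  let ?xs = "map (fractal_enum a) [2 ^ i..<2 ^ Suc i]"
  have "sorted_wrt (<) ?xs"
    unfolding sorted_wrt_map
    by (rule sorted_wrt_mono_rel[OF _ sorted_wrt_upt])
       (use fractal_enum_less[OF assms] in \<open>auto dest!: one_le_of_power2_le\<close>)
  then have "sorted_list_of_set (set ?xs) = ?xs"
    by (intro sorted_list_of_set.idem_if_sorted_distinct) (auto simp: strict_sorted_iff)
  then show ?thesis by (simp add: enum_period_def)
qed

lemma offset_enum_period:
  assumes "0 < a" "a < 1" "r \<le> 2 ^ i"
  shows "offset i (enum_period a i) r = fractal_enum a (2 ^ i + r) - real i"
proof (cases "r = 2 ^ i")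
  case True
  then show ?thesis
    using fractal_enum_power2[of a "Suc i"] 
    by (simp add: offset_def card_enum_period[OF assms(1,2)] mult_2)
next
  case False
  then have "r < 2 ^ i" using assms by simp
  then show ?thesis
    by (simp add: offset_def card_enum_period[OF assms(1,2)]
        sorted_list_of_enum_period[OF assms(1,2)] del: upt_Suc)
qed

lemma enum_period_1: "enum_period a 1 = {1, 1 + a}"
proof -
  have "{2 ^ 1..<2 ^ Suc 1} = {2, 3 :: nat}" by auto
  then show ?thesis by (simp add: enum_period_def fractal_enum_2 fractal_enum_3)
qed

text \<open>Cutting the interval between two consecutive elements \<open>n\<close> and \<open>n + 1\<close> of a period produces
  exactly the elements \<open>2 * n\<close> and \<open>2 * n + 1\<close>, so the prescribed recursion on periods is the recursion
  of the enumeration.\<close>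

lemma next_period_enum_period:
  assumes "0 < a" "a < 1"
  shows "next_period {1, 1 + a} i (enum_period a i) = enum_period a (Suc i)"
proof -
  let ?f = "fractal_enum a"
  have card: "card {1, 1 + a} = 2" using assms by simp
  have off: "offset 1 {1, 1 + a} 0 = 0" "offset 1 {1, 1 + a} (Suc 0) = a"
    using offset_enum_period[OF assms, of 0 1] offset_enum_period[OF assms, of 1 1]
    by (simp_all add: enum_period_1[simplified] fractal_enum_2 fractal_enum_3)
  have halves: "{..<2::nat} = {0, Suc 0}" by auto
  have step: "(\<Union>s\<in>{..<card {1, 1 + a}}. {(real i + 1) + offset i (enum_period a i) r +
        offset 1 {1, 1 + a} s * (offset i (enum_period a i) (Suc r) - offset i (enum_period a i) r)})
      = ?f ` {2 * (2 ^ i + r), 2 * (2 ^ i + r) + 1}" if "r < 2 ^ i" for r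
    using that fractal_enum_even[of "2 ^ i + r" a] fractal_enum_odd[of "2 ^ i + r" a]
    unfolding card halves
    by (auto simp: off[simplified] offset_enum_period[OF assms] one_le_of_power2_le[of i])
  have "next_period {1, 1 + a} i (enum_period a i)
      = (\<Union>r\<in>{..<2 ^ i}. ?f ` {2 * (2 ^ i + r), 2 * (2 ^ i + r) + 1})"
    unfolding next_period_def card_enum_period[OF assms] by (rule SUP_cong) (use step in auto)
  also have "\<dots> = ?f ` (\<Union>r\<in>{..<2 ^ i}. {2 * (2 ^ i + r), 2 * (2 ^ i + r) + 1})"
    by blast
  also have "(\<Union>r\<in>{..<2 ^ i}. {2 * (2 ^ i + r), 2 * (2 ^ i + r) + 1}) = {2 ^ Suc i..<2 ^ Suc (Suc i) :: nat}"
  proof (intro equalityI subsetI)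
    fix n :: nat
    assume n: "n \<in> {2 ^ Suc i..<2 ^ Suc (Suc i)}"
    define r where "r = n div 2 - 2 ^ i"
    have "r < 2 ^ i" "n = 2 * (2 ^ i + r) \<or> n = 2 * (2 ^ i + r) + 1"
      using n by (auto simp: r_def)
    then show "n \<in> (\<Union>r\<in>{..<2 ^ i}. {2 * (2 ^ i + r), 2 * (2 ^ i + r) + 1})" by blast
  qed auto
  finally show ?thesis by (simp add: enum_period_def)
qed

lemma generated_period_eq_enum_period:
  assumes "0 < a" "a < 1"
  shows "generated_period {1, 1 + a} (Suc i) = enum_period a (Suc i)"
proof (induction i)
  case 0
  then show ?case using enum_period_1[of a] by simp
next
  case (Suc i)
  then show ?case using next_period_enum_period[OF assms, of "Suc i"] by simp
qed

lemma Union_enum_period: "(\<Union>i. enum_period a i) = fractal_enum a ` {1..}"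
proof -
  have "\<exists>i. n \<in> {2 ^ i..<2 ^ Suc i}" if "1 \<le> n" for n :: nat
    using ex_power_ivl1[of 2 n] that by auto
  then show ?thesis
    by (fastforce simp: enum_period_def dest: one_le_of_power2_le)
qed

lemma generated_set_eq_enum:
  assumes "0 < a" "a < 1"
  shows "generated_set {1, 1 + a} = fractal_enum a ` {1..}"
proof -
  have UNIV: "UNIV = insert 0 (range Suc)"
    by (rule set_eqI) (metis UNIV_I insert_iff not0_implies_Suc rangeI)
  have Suc: "{1..} = range Suc"
    by (metis atLeast_Suc_greaterThan greaterThan_0 One_nat_def)
  have "(\<Union>i\<in>{1..}. generated_period {1, 1 + a} i) = (\<Union>i. enum_period a (Suc i))"
    unfolding Suc by (simp only: image_image generated_period_eq_enum_period[OF assms])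
  moreover have "enum_period a 0 = {0}"
    by (simp add: enum_period_def atLeastLessThanSuc numeral_2_eq_2)
  moreover have "(\<Union>i. enum_period a i) = enum_period a 0 \<union> (\<Union>i. enum_period a (Suc i))"
    by (subst UNIV) (simp only: UN_insert image_image)
  ultimately show ?thesis
    unfolding generated_set_def Union_enum_period[symmetric] by simp
qed

lemma fractal_enum_period_bounds:
  assumes "0 < a" "a < 1" "2 ^ i \<le> n" "n < 2 ^ Suc i"
  shows "real i \<le> fractal_enum a n" "fractal_enum a n < real i + 1"
  using fractal_enum_less[OF assms(1,2), of "2 ^ i" n] assms
    fractal_enum_less[OF assms(1,2), of n "2 ^ Suc i"] one_le_of_power2_le[OF assms(3)]
    fractal_enum_power2[of a i] fractal_enum_power2[of a "Suc i"]
  by (cases "n = 2 ^ i"; simp)+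

lemma period_generated_set:
  assumes "0 < a" "a < 1"
  shows "period (generated_set {1, 1 + a}) i = enum_period a i"
proof (intro equalityI subsetI)
  fix x
  assume "x \<in> enum_period a i"
  then show "x \<in> period (generated_set {1, 1 + a}) i"
    using fractal_enum_period_bounds[OF assms]
    by (auto simp: period_def generated_set_eq_enum[OF assms] enum_period_def
        dest: one_le_of_power2_le)
next
  fix x
  assume x: "x \<in> period (generated_set {1, 1 + a}) i"
  then have "x \<in> (\<Union>i. enum_period a i)"
    unfolding Union_enum_period by (simp add: period_def generated_set_eq_enum[OF assms])
  then obtain j where j: "x \<in> enum_period a j" by blast
  then have "real j \<le> x" "x < real j + 1"
    using fractal_enum_period_bounds[OF assms] by (auto simp: enum_period_def)
  then have "i = j" using x by (auto simp: period_def)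
  then show "x \<in> enum_period a i" using j by simp
qed

text \<open>Monotonicity and vanishing gaps come for free from the enumeration; closure under addition is
  the only property that depends on the value of \<open>a\<close>.\<close>

lemma tempered_generated_set:
  assumes "0 < a" "a < 1"
    and add: "\<And>x y. x \<in> generated_set {1, 1 + a} \<Longrightarrow> y \<in> generated_set {1, 1 + a} \<Longrightarrow>
      x + y \<in> generated_set {1, 1 + a}"
  shows "tempered_monoid (generated_set {1, 1 + a})"
proof -
  define \<mu> where "\<mu> n = fractal_enum a (Suc n)" for n
  have range: "generated_set {1, 1 + a} = range \<mu>"
    unfolding generated_set_eq_enum[OF assms(1,2)] \<mu>_def
    by (auto simp: image_def) (metis Suc_le_D)
  have mono: "strict_mono \<mu>"
    using fractal_enum_less[OF assms(1,2)] by (auto simp: strict_mono_def \<mu>_def)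
  have "\<mu> 0 = 0" by (simp add: \<mu>_def)
  moreover from this have "0 \<le> \<mu> n" for n
    using strict_mono_less_eq[OF mono, of 0 n] by simp
  moreover have "(\<lambda>n. \<mu> (Suc n) - \<mu> n) \<longlonglongrightarrow> 0"
    using gap_tendsto_0[OF assms(1,2)] by (simp add: \<mu>_def gap_def)
  moreover have "\<exists>k. \<mu> k = \<mu> i + \<mu> j" for i j
    using add[of "\<mu> i" "\<mu> j"] by (auto simp: range image_iff eq_commute)
  ultimately show ?thesis
    using mono range by (auto simp: tempered_monoid_def tempered_sequence_def)
qed

section \<open>Fractal monoids are determined by their first period\<close>

lemma tempered_monoid_zero: "tempered_monoid M \<Longrightarrow> 0 \<in> M"
  unfolding tempered_monoid_def tempered_sequence_def by (metis rangeI)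

lemma tempered_monoid_nonneg: "tempered_monoid M \<Longrightarrow> x \<in> M \<Longrightarrow> 0 \<le> x"
  unfolding tempered_monoid_def tempered_sequence_def by auto

lemma tempered_monoid_add: "tempered_monoid M \<Longrightarrow> x \<in> M \<Longrightarrow> y \<in> M \<Longrightarrow> x + y \<in> M"
  unfolding tempered_monoid_def tempered_sequence_def by (auto simp: image_iff) metis

lemma fractal_monoid_eq_generated_set:
  assumes "fractal_monoid M"
  shows "M = generated_set (period M 1)"
proof -
  have tm: "tempered_monoid M" and norm: "normalized M"
    and rec: "\<And>i. i \<ge> 1 \<Longrightarrow> period M (i + 1) = next_period (period M 1) i (period M i)"
    using assms by (auto simp: fractal_monoid_def)
  have per: "generated_period (period M 1) (Suc i) = period M (Suc i)" for i
  proof (induction i)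
    case (Suc i)
    then show ?case using rec[of "Suc i"] by simp
  qed simp
  show ?thesis
  proof (intro equalityI subsetI)
    fix x
    assume x: "x \<in> M"
    show "x \<in> generated_set (period M 1)"
    proof (cases "x = 0")
      case False
      then have "1 \<le> x" using norm x by (auto simp: normalized_def)
      then obtain i where "nat \<lfloor>x\<rfloor> = Suc i"
        by (metis One_nat_def Suc_le_D le_nat_floor of_nat_1)
      then have "x \<in> period M (Suc i)"
        using x \<open>1 \<le> x\<close> by (auto simp: period_def) linarith+
      then show ?thesis using per[of i] by (auto simp: generated_set_def)
    qed (simp add: generated_set_def)
  next
    fix x
    assume "x \<in> generated_set (period M 1)"
    then consider "x = 0" | i where "i \<ge> 1" "x \<in> generated_period (period M 1) i"
      by (auto simp: generated_set_def)
    then show "x \<in> M"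
    proof cases
      case 1
      then show ?thesis using tempered_monoid_zero[OF tm] by simp
    next
      case (2 i)
      then show ?thesis using per[of "i - 1"] by (auto simp: period_def)
    qed
  qed
qed

section \<open>Self-similarity\<close>

text \<open>The recursion that generates the periods refines the last cut. Reading the same subdivision
  from the first cut on, the part in \<open>[0, a)\<close> and the part in \<open>[a, 1)\<close> are scaled copies of the
  subdivision of the previous level.\<close>

primrec endpoints :: "real \<Rightarrow> nat \<Rightarrow> real set" where
  "endpoints a 0 = {0}"
| "endpoints a (Suc i) = (\<lambda>x. a * x) ` endpoints a i \<union> (\<lambda>x. a + (1 - a) * x) ` endpoints a i"

declare endpoints.simps(2) [simp del]

lemma endpoints_left: "x \<in> endpoints a i \<Longrightarrow> a * x \<in> endpoints a (Suc i)"
  unfolding endpoints.simps by blast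

lemma endpoints_right: "x \<in> endpoints a i \<Longrightarrow> a + (1 - a) * x \<in> endpoints a (Suc i)"
  unfolding endpoints.simps by blast

lemma endpoints_cases:
  assumes "x \<in> endpoints a (Suc i)"
  obtains (left) u where "u \<in> endpoints a i" "x = a * u"
    | (right) u where "u \<in> endpoints a i" "x = a + (1 - a) * u"
  using assms by (auto simp: endpoints.simps(2))

lemma endpoints_Suc_subset: "endpoints a i \<subseteq> endpoints a (Suc i)"
proof (induction i)
  case (Suc i)
  then show ?case by (subst (1 2) endpoints.simps) blast
qed (simp add: endpoints.simps(2))

lemma endpoints_mono: "i \<le> j \<Longrightarrow> x \<in> endpoints a i \<Longrightarrow> x \<in> endpoints a j"
  using lift_Suc_mono_le[of "endpoints a"] endpoints_Suc_subset by blast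

lemma endpoints_bounds:
  assumes "0 < a" "a < 1" "x \<in> endpoints a i"
  shows "0 \<le> x \<and> x < 1"
  using assms(3)
proof (induction i arbitrary: x)
  case (Suc i)
  from Suc.prems show ?case
  proof (cases rule: endpoints_cases)
    case (left u)
    then have "0 \<le> u" "u < 1" using Suc.IH by auto
    then have "a * u < a * 1" using assms by (intro mult_strict_left_mono) auto
    then have "a * u < 1" using assms(2) by linarith
    then show ?thesis using left(2) assms(1) \<open>0 \<le> u\<close> by simp
  next
    case (right u)
    then have "0 \<le> u" "u < 1" using Suc.IH by auto
    then have "0 < (1 - a) * (1 - u)" using assms(2) by simp
    then have "a + (1 - a) * u < 1" by (simp add: algebra_simps)
    then show ?thesis using right(2) assms(1,2) \<open>0 \<le> u\<close> by simp
  qed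
qed simp

text \<open>The first half of a period is the previous period scaled by \<open>a\<close>. The refinement rule commutes
  with affine maps, so the claim passes from one level to the next. The case \<open>r = 2 ^ i\<close>, the right
  end of the half, is included because the rule for an odd index also looks at the next element.\<close>

lemma fractal_enum_left_half:
  "r \<le> 2 ^ i \<Longrightarrow>
     fractal_enum a (2 ^ Suc i + r) - real (Suc i) = a * (fractal_enum a (2 ^ i + r) - real i)"
proof (induction i arbitrary: r)
  case 0
  then have "r = 0 \<or> r = 1" by force
  then show ?case
    using fractal_enum_2[of a] fractal_enum_3[of a] by (auto simp: numeral_eq_Suc)
next
  case (Suc i)
  define s where "s = r div 2"
  have pos: "2 ^ i + s \<ge> (1::nat)" "2 ^ Suc i + s \<ge> (1::nat)"
    by (rule one_le_of_power2_le[of i], simp)+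
  have s: "s \<le> 2 ^ i" using Suc.prems by (simp add: s_def)
  show ?case
  proof (cases "even r")
    case True
    then have "r = 2 * s" by (simp add: s_def)
    then show ?thesis
      using Suc.IH[OF s] fractal_enum_even[OF pos(1), of a] fractal_enum_even[OF pos(2), of a]
      by (simp add: algebra_simps)
  next
    case False
    then have r: "r = 2 * s + 1" by (simp add: s_def)
    then have s1: "s + 1 \<le> 2 ^ i" using Suc.prems by simp
    have "fractal_enum a (2 ^ Suc (Suc i) + r) = 1 + fractal_enum a (2 ^ Suc i + s) +
        a * (fractal_enum a (2 ^ Suc i + (s + 1)) - fractal_enum a (2 ^ Suc i + s))"
      using fractal_enum_odd[OF pos(2), of a] r by (simp add: algebra_simps)
    moreover have "fractal_enum a (2 ^ Suc i + r) = 1 + fractal_enum a (2 ^ i + s) +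
        a * (fractal_enum a (2 ^ i + (s + 1)) - fractal_enum a (2 ^ i + s))"
      using fractal_enum_odd[OF pos(1), of a] r by (simp add: algebra_simps)
    moreover note Suc.IH[OF s] Suc.IH[OF s1]
    ultimately show ?thesis unfolding of_nat_Suc by algebra
  qed
qed

lemma fractal_enum_right_half:
  "r \<le> 2 ^ i \<Longrightarrow>
     fractal_enum a (2 ^ Suc i + 2 ^ i + r) - real (Suc i) =
       a + (1 - a) * (fractal_enum a (2 ^ i + r) - real i)"
proof (induction i arbitrary: r)
  case 0
  have "fractal_enum a 4 = 2" using fractal_enum_power2[of a 2] by simp
  moreover from 0 have "r = 0 \<or> r = 1" by force
  ultimately show ?case
    using fractal_enum_2[of a] fractal_enum_3[of a] by (auto simp: numeral_eq_Suc)
next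
  case (Suc i)
  define s where "s = r div 2"
  have pos: "2 ^ i + s \<ge> (1::nat)" "2 ^ Suc i + 2 ^ i + s \<ge> (1::nat)"
    by (rule one_le_of_power2_le[of i], simp)+
  have s: "s \<le> 2 ^ i" using Suc.prems by (simp add: s_def)
  show ?case
  proof (cases "even r")
    case True
    then have "r = 2 * s" by (simp add: s_def)
    then show ?thesis
      using Suc.IH[OF s] fractal_enum_even[OF pos(1), of a] fractal_enum_even[OF pos(2), of a]
      by (simp add: algebra_simps)
  next
    case False
    then have r: "r = 2 * s + 1" by (simp add: s_def)
    then have s1: "s + 1 \<le> 2 ^ i" using Suc.prems by simp
    have "fractal_enum a (2 ^ Suc (Suc i) + 2 ^ Suc i + r) =
        1 + fractal_enum a (2 ^ Suc i + 2 ^ i + s) +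
        a * (fractal_enum a (2 ^ Suc i + 2 ^ i + (s + 1)) - fractal_enum a (2 ^ Suc i + 2 ^ i + s))"
      using fractal_enum_odd[OF pos(2), of a] r by (simp add: algebra_simps)
    moreover have "fractal_enum a (2 ^ Suc i + r) = 1 + fractal_enum a (2 ^ i + s) +
        a * (fractal_enum a (2 ^ i + (s + 1)) - fractal_enum a (2 ^ i + s))"
      using fractal_enum_odd[OF pos(1), of a] r by (simp add: algebra_simps)
    moreover note Suc.IH[OF s] Suc.IH[OF s1]
    ultimately show ?thesis unfolding of_nat_Suc by algebra
  qed
qed

lemma image_plus_power2: "(\<lambda>r. 2 ^ i + r) ` {..<2 ^ i} = {2 ^ i..<2 ^ Suc i :: nat}"
  by (simp add: lessThan_atLeast0 mult_2)

lemma endpoints_eq_enum: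
  "endpoints a i = (\<lambda>r. fractal_enum a (2 ^ i + r) - real i) ` {..<2 ^ i}"
proof (induction i)
  case 0
  show ?case by (simp add: lessThan_Suc)
next
  case (Suc i)
  let ?g = "\<lambda>r. fractal_enum a (2 ^ Suc i + r) - real (Suc i)"
  have split: "{..<2 ^ Suc i} = {..<2 ^ i} \<union> (\<lambda>r. 2 ^ i + r) ` {..<2 ^ i :: nat}"
    unfolding image_plus_power2 by auto
  have "?g ` {..<2 ^ i} = (\<lambda>x. a * x) ` endpoints a i"
    unfolding Suc.IH image_image
    by (rule image_cong[OF refl]) (use fractal_enum_left_half[of _ i a] in simp)
  moreover have "?g ` (\<lambda>r. 2 ^ i + r) ` {..<2 ^ i} = (\<lambda>x. a + (1 - a) * x) ` endpoints a i"
    unfolding Suc.IH image_image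
    by (rule image_cong[OF refl]) (use fractal_enum_right_half[of _ i a] in \<open>simp add: add.assoc\<close>)
  ultimately show ?case by (simp only: split image_Un endpoints.simps)
qed

lemma enum_period_eq_endpoints: "enum_period a i = (\<lambda>x. real i + x) ` endpoints a i"
  unfolding enum_period_def image_plus_power2[symmetric]
  by (simp add: endpoints_eq_enum image_image)

lemma generated_set_iff_endpoints:
  assumes "0 < a" "a < 1"
  shows "x \<in> generated_set {1, 1 + a} \<longleftrightarrow> (\<exists>i. \<exists>u\<in>endpoints a i. x = real i + u)"
  unfolding generated_set_eq_enum[OF assms] Union_enum_period[symmetric] enum_period_eq_endpoints
  by auto

section \<open>The golden ratio\<close>

text \<open>Write \<open>L\<close> for \<open>x \<mapsto> a * x\<close> and \<open>R\<close> for \<open>x \<mapsto> a + (1 - a) * x\<close>. Because of \<open>a * a = 1 - a\<close>, sums of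
  images under these maps can be rewritten, for example
  \<open>L u + L v = L (u + v)\<close>, \<open>L (L u) + R v = R (u + v)\<close> and
  \<open>R u + R v = 1 + L (L (a + (u + v)))\<close>. The inner sum has smaller total level and is therefore known,
  up to a carry of 1, to be an endpoint. The carry is absorbed by identities such as
  \<open>a + L (L z) = R z\<close> and \<open>a + L (R z) = 1 + L (L (L z))\<close>. In every case the number of maps applied
  stays within the allowed level.\<close>

lemma golden_endpoints_add:
  assumes a0: "0 < a" and gold: "a * a = 1 - a"
  shows "x \<in> endpoints a i \<Longrightarrow> y \<in> endpoints a j \<Longrightarrow>
    x + y \<in> endpoints a (i + j) \<or> x + y - 1 \<in> endpoints a (i + j + 1)"
proof (induction "i + j" arbitrary: i j x y rule: less_induct)
  case less
  have a1: "a < 1" using a0 gold by (metis diff_gt_0_iff_gt mult_pos_pos)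
  note L = endpoints_left[of _ a] and R = endpoints_right[of _ a]
  \<comment> \<open>One summand in each half. The scales \<open>a\<close> and \<open>a * a\<close> of the two halves differ by a factor \<open>a\<close>,
    so one more map has to be stripped from the summand in the left half.\<close>
  have mixed: "x + y \<in> endpoints a (p + q + 2) \<or> x + y - 1 \<in> endpoints a (p + q + 3)"
    if less': "p + q + 2 = i + j" and u: "u \<in> endpoints a p" "x = a * u"
      and v: "v \<in> endpoints a q" "y = a + (1 - a) * v" for p q u v x y
  proof (cases p)
    case 0
    then have "x = 0" using u by simp
    then show ?thesis using endpoints_mono[OF _ R[OF v(1)], of "p + q + 2"] v by simp
  next
    case (Suc p')
    from u(1)[unfolded Suc] show ?thesis
    proof (cases rule: endpoints_cases)
      case (left w)
      have "w + v \<in> endpoints a (p' + q) \<or> w + v - 1 \<in> endpoints a (p' + q + 1)"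
        using less.hyps[of p' q w v] less' Suc left v by simp
      then show ?thesis
      proof
        assume "w + v \<in> endpoints a (p' + q)"
        from R[OF this] have "a + (1 - a) * (w + v) \<in> endpoints a (p + q + 2)"
          by (rule endpoints_mono[rotated]) (simp add: Suc)
        moreover have "x + y = a + (1 - a) * (w + v)" using u v left gold by algebra
        ultimately show ?thesis by simp
      next
        assume "w + v - 1 \<in> endpoints a (p' + q + 1)"
        from L[OF L[OF this]] have "a * (a * (w + v - 1)) \<in> endpoints a (p + q + 3)"
          by (rule endpoints_mono[rotated]) (simp add: Suc)
        moreover have "x + y - 1 = a * (a * (w + v - 1))" using u v left gold by algebra
        ultimately show ?thesis by simp
      qed
    next
      case (right w)
      have "a * w + v \<in> endpoints a (p + q) \<or> a * w + v - 1 \<in> endpoints a (p + q + 1)"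
        using less.hyps[of p q "a * w" v] less' Suc L[OF right(1)] v by simp
      then show ?thesis
      proof
        assume "a * w + v \<in> endpoints a (p + q)"
        from L[OF L[OF this]] have "a * (a * (a * w + v)) \<in> endpoints a (p + q + 3)"
          by (rule endpoints_mono[rotated]) simp
        moreover have "x + y - 1 = a * (a * (a * w + v))" using u v right gold by algebra
        ultimately show ?thesis by simp
      next
        assume "a * w + v - 1 \<in> endpoints a (p + q + 1)"
        then have "a * w + v - 1 \<in> endpoints a (Suc (p + q))" by simp
        then show ?thesis
        proof (cases rule: endpoints_cases)
          case (left z)
          from L[OF R[OF left(1)]] have "a * (a + (1 - a) * z) \<in> endpoints a (p + q + 3)"
            by (rule endpoints_mono[rotated]) simp
          moreover have "x + y - 1 = a * (a + (1 - a) * z)"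
            using u v right left gold by algebra
          ultimately show ?thesis by simp
        next
          case z: (right z)
          from R[OF L[OF L[OF z(1)]]] have "a + (1 - a) * (a * (a * z)) \<in> endpoints a (p + q + 3)"
            by (rule endpoints_mono[rotated]) simp
          moreover have "x + y - 1 = a + (1 - a) * (a * (a * z))"
            using u v right z gold by algebra
          ultimately show ?thesis by simp
        qed
      qed
    qed
  qed
  show ?case
  proof (cases i)
    case 0
    then show ?thesis using less.prems by simp
  next
    case i: (Suc p)
    show ?thesis
    proof (cases j)
      case 0
      then show ?thesis using less.prems by simp
    next
      case j: (Suc q)
      have lev: "i + j = p + q + 2" "i + j + 1 = p + q + 3" using i j by auto
      note x = less.prems(1)[unfolded i] and y = less.prems(2)[unfolded j]
      have IH: "u + v \<in> endpoints a (p + q) \<or> u + v - 1 \<in> endpoints a (Suc (p + q))"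
        if "u \<in> endpoints a p" "v \<in> endpoints a q" for u v
        using less.hyps[of p q u v] that lev by simp
      from x show ?thesis
      proof (cases rule: endpoints_cases)
        case xl: (left u)
        from y show ?thesis
        proof (cases rule: endpoints_cases)
          case yl: (left v)
          from IH[OF xl(1) yl(1)] show ?thesis
          proof
            assume "u + v \<in> endpoints a (p + q)"
            from L[OF this] have "a * (u + v) \<in> endpoints a (i + j)"
              by (rule endpoints_mono[rotated]) (simp add: lev)
            moreover have "x + y = a * (u + v)" using xl yl by algebra
            ultimately show ?thesis by simp
          next
            assume "u + v - 1 \<in> endpoints a (Suc (p + q))"
            then show ?thesis
            proof (cases rule: endpoints_cases)
              case (left z)
              from R[OF left(1)] have "a + (1 - a) * z \<in> endpoints a (i + j)"
                by (rule endpoints_mono[rotated]) (simp add: lev)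
              moreover have "x + y = a + (1 - a) * z" using xl yl left gold by algebra
              ultimately show ?thesis by simp
            next
              case (right z)
              from L[OF L[OF L[OF right(1)]]] have "a * (a * (a * z)) \<in> endpoints a (i + j + 1)"
                by (rule endpoints_mono[rotated]) (simp add: lev)
              moreover have "x + y - 1 = a * (a * (a * z))" using xl yl right gold by algebra
              ultimately show ?thesis by simp
            qed
          qed
        next
          case yr: (right v)
          show ?thesis using mixed[OF _ xl yr] unfolding lev(2) unfolding lev(1) by simp
        qed
      next
        case xr: (right u)
        from y show ?thesis
        proof (cases rule: endpoints_cases)
          case yl: (left v)
          show ?thesis using mixed[OF _ yl xr] unfolding lev(2) unfolding lev(1) by (simp add: add.commute)
        next
          case yr: (right v)
          from IH[OF xr(1) yr(1)] show ?thesis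
          proof
            assume uv: "u + v \<in> endpoints a (p + q)"
            \<comment> \<open>The induction hypothesis is used a second time, for the sum of \<open>a\<close> and \<open>u + v\<close>; the
              two cuts already stripped leave room for the level 1 of \<open>a\<close>.\<close>
            have "a \<in> endpoints a 1" by (simp add: endpoints.simps(2))
            then have "a + (u + v) \<in> endpoints a (1 + (p + q)) \<or>
                a + (u + v) - 1 \<in> endpoints a (1 + (p + q) + 1)"
              using less.hyps[of 1 "p + q"] uv lev by simp
            then show ?thesis
            proof
              assume "a + (u + v) \<in> endpoints a (1 + (p + q))"
              from L[OF L[OF this]] have "a * (a * (a + (u + v))) \<in> endpoints a (i + j + 1)"
                by (rule endpoints_mono[rotated]) (simp add: lev)
              moreover have "x + y - 1 = a * (a * (a + (u + v)))" using xr yr gold by algebra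
              ultimately show ?thesis by simp
            next
              assume "a + (u + v) - 1 \<in> endpoints a (1 + (p + q) + 1)"
              then have "a + (u + v) - 1 \<in> endpoints a (Suc (Suc (p + q)))" by simp
              then show ?thesis
              proof (cases rule: endpoints_cases)
                case (left z)
                from L[OF R[OF left(1)]] have "a * (a + (1 - a) * z) \<in> endpoints a (i + j + 1)"
                  by (rule endpoints_mono[rotated]) (simp add: lev)
                moreover have "x + y - 1 = a * (a + (1 - a) * z)" using xr yr left gold by algebra
                ultimately show ?thesis by simp
              next
                case (right z)
                \<comment> \<open>Impossible: \<open>a + (u + v) - 1\<close> is less than \<open>a\<close>.\<close>
                have "u + v < 1" using endpoints_bounds[OF a0 a1 uv] by simp
                moreover have "0 \<le> (1 - a) * z"
                  using endpoints_bounds[OF a0 a1 right(1)] a1 by simp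
                ultimately show ?thesis using right by linarith
              qed
            qed
          next
            assume "u + v - 1 \<in> endpoints a (Suc (p + q))"
            from R[OF this] have "a + (1 - a) * (u + v - 1) \<in> endpoints a (i + j + 1)"
              by (rule endpoints_mono[rotated]) (simp add: lev)
            moreover have "x + y - 1 = a + (1 - a) * (u + v - 1)" using xr yr gold by algebra
            ultimately show ?thesis by simp
          qed
        qed
      qed
    qed
  qed
qed

lemma golden_generated_set_add:
  assumes "0 < a" "a * a = 1 - a"
    and "x \<in> generated_set {1, 1 + a}" "y \<in> generated_set {1, 1 + a}"
  shows "x + y \<in> generated_set {1, 1 + a}"
proof -
  have a1: "a < 1" using assms by (metis diff_gt_0_iff_gt mult_pos_pos)
  obtain i j u v where u: "u \<in> endpoints a i" "x = real i + u"
    and v: "v \<in> endpoints a j" "y = real j + v"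
    using assms(3,4) unfolding generated_set_iff_endpoints[OF assms(1) a1] by blast
  have "x + y = real (i + j) + (u + v)" "x + y = real (i + j + 1) + (u + v - 1)"
    using u v by simp_all
  then show ?thesis
    using golden_endpoints_add[OF assms(1,2) u(1) v(1)]
    unfolding generated_set_iff_endpoints[OF assms(1) a1] by blast
qed

text \<open>The number \<open>2 * (1 + a)\<close> has to lie in period 2 or 3. In period 2 its offset would be
  \<open>2 * a\<close>, which exceeds every offset there. In period 3 the offset \<open>2 * a - 1\<close> is below \<open>a\<close>, so it is
  one of the four offsets \<open>a * w\<close> in the left half, and each of the four equations factors.\<close>

lemma double_in_generated_set_imp:
  assumes "0 < a" "a < 1" "2 * (1 + a) \<in> generated_set {1, 1 + a}"
  shows "a = 1 / 2 \<or> a * a = 1 - a"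
proof -
  obtain i u where u: "u \<in> endpoints a i" "2 * (1 + a) = real i + u"
    using assms(3) unfolding generated_set_iff_endpoints[OF assms(1,2)] by blast
  have bounds: "0 \<le> u" "u < 1" using endpoints_bounds[OF assms(1,2) u(1)] by auto
  then have "1 < real i" using u(2) assms(1) by argo
  moreover have "real i < 4" using u(2) assms(2) bounds by argo

  ultimately have "i = 2 \<or> i = 3" by auto
  then show ?thesis
  proof
    assume i: "i = 2"
    then have "2 * a = u" using u by simp
    moreover have "u \<in> {0, a * a, a, a + (1 - a) * a}"
      using u(1) by (auto simp: i numeral_2_eq_2 endpoints.simps(2))
    moreover have "a * a < a * 1" "(1 - a) * a < 1 * a"
      using assms by (simp_all add: mult_strict_left_mono mult_strict_right_mono)
    ultimately show ?thesis using assms by auto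
  next
    assume i: "i = 3"
    then have ua: "u = 2 * a - 1" using u by simp
    have "u \<in> endpoints a (Suc 2)" using u(1) i by (simp add: numeral_3_eq_3 numeral_2_eq_2)
    then show ?thesis
    proof (cases rule: endpoints_cases)
      case (left w)
      then have "w \<in> {0, a * a, a, a + (1 - a) * a}"
        by (auto simp: numeral_2_eq_2 endpoints.simps(2))
      then consider "2 * a - 1 = 0" | "2 * a - 1 = a * (a * a)" | "2 * a - 1 = a * a"
        | "2 * a - 1 = a * (a + (1 - a) * a)"
        using left(2) ua by auto
      then show ?thesis
      proof cases
        case 2
        then have "(a - 1) * (a * a + a - 1) = 0" by algebra
        then show ?thesis using assms by auto
      next
        case 3
        then have "(a - 1) * (a - 1) = 0" by algebra
        then show ?thesis using assms by simp
      next
        case 4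
        then have "(a - 1) * (a * a - a + 1) = 0" by algebra
        then have "a * a + (1 - a) = 0" using assms by simp
        then show ?thesis using assms by (smt (verit) mult_pos_pos)
      qed simp
    next
      case (right w)
      then have "0 \<le> (1 - a) * w" using endpoints_bounds[OF assms(1,2) right(1)] assms by simp
      then show ?thesis using right ua assms by linarith
    qed
  qed
qed

theorem theorem5p9:
  fixes \<phi> :: real
  assumes "\<phi> = (1 + sqrt 5) / 2"
  shows "generates_fractal_monoid {1, \<phi>} \<and>
         {M. nonbisectional M} = {generated_set {1, \<phi>}}"
proof -
  define g where "g = \<phi> - 1"
  have \<phi>: "\<phi> = 1 + g" by (simp add: g_def)
  have g: "g = (sqrt 5 - 1) / 2" using assms by (simp add: g_def field_simps)
  have "2 < sqrt 5" "sqrt 5 < 3" by (simp_all add: real_less_rsqrt real_less_lsqrt)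
  then have g0: "0 < g" and g1: "g < 1" and g_half: "1 / 2 < g" using g by simp_all
  have gold: "g * g = 1 - g" by (simp add: g field_simps)
  let ?G = "generated_set {1, \<phi>}"
  have temp: "tempered_monoid ?G"
    unfolding \<phi> by (rule tempered_generated_set[OF g0 g1 golden_generated_set_add[OF g0 gold]])
  have gen: "generates_fractal_monoid {1, \<phi>}"
    using temp g0 g1 by (auto simp: generates_fractal_monoid_def \<phi>)
  have per: "period ?G i = enum_period g i" for i
    unfolding \<phi> by (rule period_generated_set[OF g0 g1])
  have per1: "period ?G 1 = {1, 1 + g}" using per[of 1] enum_period_1 by simp
  have "normalized ?G"
    unfolding normalized_def
  proof (intro conjI ballI impI)
    show "1 \<in> ?G" using per1 by (auto simp: period_def)
  next
    fix x
    assume "x \<in> ?G" "x \<noteq> 0"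
    show "1 \<le> x"
    proof (rule ccontr)
      assume "\<not> 1 \<le> x"
      then have "x \<in> period ?G 0"
        using \<open>x \<in> ?G\<close> tempered_monoid_nonneg[OF temp] by (simp add: period_def)
      then show False
        using \<open>x \<noteq> 0\<close> by (simp add: per enum_period_eq_endpoints)
    qed
  qed
  then have frac: "fractal_monoid ?G"
    using temp next_period_enum_period[OF g0 g1]
    by (simp add: fractal_monoid_def per per1[unfolded per] enum_period_1[simplified])
  have gran: "granularity ?G = 2" using g0 by (simp add: granularity_def per1[simplified])
  have "?G \<noteq> bisectional_monoid"
  proof
    assume "?G = bisectional_monoid"
    then have "period ?G 1 = {1, 1 + 1 / 2}"
      using period_generated_set[of "1 / 2" 1] enum_period_1[of "1 / 2"]
      by (simp add: bisectional_monoid_def)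
    then show False using per1 g0 g_half by (auto simp: doubleton_eq_iff)
  qed
  then have G: "nonbisectional ?G" using frac gran by (simp add: nonbisectional_def)
  have "M = ?G" if M: "nonbisectional M" for M
  proof -
    have frac: "fractal_monoid M" and card: "card (period M 1) = 2" and nb: "M \<noteq> bisectional_monoid"
      using M by (auto simp: nonbisectional_def granularity_def)
    have tm: "tempered_monoid M" and "1 \<in> period M 1"
      using frac by (auto simp: fractal_monoid_def normalized_def period_def)
    then obtain c where c: "period M 1 = {1, c}" "c \<noteq> 1"
      using card by (metis card_2_iff doubleton_eq_iff insertE singletonD)
    then have "c \<in> period M 1" by simp
    then have "1 \<le> c" "c < 2" "c \<in> M" by (auto simp: period_def)
    define a where "a = c - 1"
    have a: "0 < a" "a < 1" "c = 1 + a" using \<open>1 \<le> c\<close> \<open>c < 2\<close> c(2) by (auto simp: a_def)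
    have M_eq: "M = generated_set {1, 1 + a}"
      using fractal_monoid_eq_generated_set[OF frac] c a by simp
    have "2 * (1 + a) \<in> M" using tempered_monoid_add[OF tm \<open>c \<in> M\<close> \<open>c \<in> M\<close>] a by simp
    then have "a = 1 / 2 \<or> a * a = 1 - a"
      using double_in_generated_set_imp[OF a(1,2)] M_eq by simp
    moreover have "a \<noteq> 1 / 2" using nb M_eq unfolding bisectional_monoid_def by blast
    ultimately have "a * a = 1 - a" by simp
    then have "(a - g) * (a + g + 1) = 0" using gold by algebra
    then have "a = g" using a g0 by simp
    then show ?thesis using M_eq \<phi> by simp
  qed
  then show ?thesis using gen G by blast
qed

end
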